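(* Let $d\ge 2$, $p\ge 1$, let $C^k_{\alpha_1,\dots,\alpha_d}\in\mathbb{R}$ be given for $0\le k\le p$ and $\alpha=(\alpha_1,\dots,\alpha_d)\in(\mathbb{Z}^+)^d$ with $|\alpha|=k$, and consider the linear partial differential equation with constant coefficients $$E(u):=\sum_{k=0}^p\ \sum_{|\alpha|=k} C^k_{\alpha_1,\dots,\alpha_d}\,\frac{\partial^k u}{\partial x_1^{\alpha_1}\cdots\partial x_d^{\alpha_d}}=0 .$$ Let $e_1,\dots,e_d$, with $e_j=\sum_{r\ge 0}a_{jr}\rho^r$, $a_{jr}\in\mathbb{C}$, be vectors on the sequence of extensions $\{\mathbb{E}^n_\rho\}_{n=2}^\infty$ which satisfy on this sequence the characteristic equation $$\sum_{k=0}^p\ \sum_{|\alpha|=k} C^k_{\alpha_1,\dots,\alpha_d}\,e_1^{\alpha_1}\cdots e_d^{\alpha_d}=0 .$$ Let $\xi=\sum_{j=1}^d x_ja_{j0}$, let $\xi_r=\sum_{j=1}^d x_ja_{jr}$ for $r\ge 1$, and let $\Psi_r$ be the polynomials in $\xi_1,\dots,\xi_r$ defined in the context. Then for every $r=0,1,2,\dots$ the complex-valued function $$V_r(x_1,\dots,x_d)=\Psi_r(x_1,\dots,x_d)\,e^{\xi(x_1,\dots,x_d)},\qquad (x_1,\dots,x_d)\in\mathbb{R}^d,$$ satisfies the equation $E(V_r)=0$.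
   Context: $\mathbb{Z}^+=\{0,1,2,\dots\}$ and $|\alpha|=\alpha_1+\dots+\alpha_d$. For $n\ge 2$, $\mathbb{E}^n_\rho$ is the $n$-dimensional commutative associative algebra over $\mathbb{C}$ with basis $\{1,\rho,\rho^2,\dots,\rho^{n-1}\}$ and $\rho^n=0$. The sequence $\{\mathbb{E}^n_\rho\}_{n=2}^\infty$ is a sequence of extensions: each algebra is obtained from the next one by setting the last basis element to zero. A vector $e=\sum_{r\ge0}c_r\rho^r$ ($c_r\in\mathbb{C}$) on this sequence means the family of its truncations $e(n)=\sum_{r=0}^{n-1}c_r\rho^r\in\mathbb{E}^n_\rho$, $n=2,3,\dots$. Vectors $e_1,\dots,e_d$ satisfy an algebraic equation on the sequence if for every $n=2,3,\dots$ the truncations $e_1(n),\dots,e_d(n)$ satisfy it in $\mathbb{E}^n_\rho$. Definition of $\Psi_r$. With $\xi=\sum_j x_ja_{j0}$, $\xi_r=\sum_j x_ja_{jr}$ ($r\ge1$) and a complex variable $t\neq\xi$, define recursively $$A_0=\frac1{t-\xi},\qquad A_s=\frac1{t-\xi}\bigl(\xi_sA_0+\xi_{s-1}A_1+\dots+\xi_1A_{s-1}\bigr),\quad s\ge1 .$$ For $r\ge 1$, $A_r$ has the form $\sum_{s=2}^{r+1}Q_{r,s}(\xi_1,\dots,\xi_r)\,(t-\xi)^{-s}$ with polynomials $Q_{r,s}$. The operator $P$ replaces $(t-\xi)^s$ by $(s-1)!$ for each $s\in\{2,\dots,r+1\}$. Set $$\Psi_0=1,\qquad \Psi_r=P A_r=\sum_{s=2}^{r+1}\frac{Q_{r,s}(\xi_1,\dots,\xi_r)}{(s-1)!},\quad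 r\ge1 .$$ For example, $\Psi_1=\xi_1$, $\Psi_2=\xi_2+\xi_1^2/2$, $\Psi_3=\xi_3+\xi_1\xi_2+\xi_1^3/3!$. Since $\xi,\xi_1,\xi_2,\dots$ are linear functions of $(x_1,\dots,x_d)$, $\Psi_r$ is also regarded as a function of $(x_1,\dots,x_d)$. *)

theory Defs
  imports
    "HOL-Analysis.Analysis"
    "HOL-Computational_Algebra.Polynomial"
    "HOL-Algebra.Module"
begin

definition complex_ring :: "complex ring" where
  "complex_ring = \<lparr>carrier = UNIV, mult = (*), one = 1, zero = 0, add = (+)\<rparr>"

text \<open>An element \<open>\<Sum>r<n. c r * rho ^ r\<close> is represented by the polynomial in \<open>rho\<close> of degree
  less than \<open>n\<close> with these coefficients; thus \<open>rho ^ n = 0\<close>.\<close>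

definition trunc_alg :: "nat \<Rightarrow> (complex, complex poly) module" where
  "trunc_alg n =
    \<lparr>carrier = {f. degree f < n}, mult = (\<lambda>f g. (f * g) mod monom 1 n), one = 1,
     zero = 0, add = (+), smult = Polynomial.smult\<rparr>"

lemma degree_mod_monom_less:
  "0 < n \<Longrightarrow> degree ((f :: complex poly) mod monom 1 n) < n"
  using degree_mod_less[of "monom 1 n" f] by (auto simp: degree_monom_eq monom_eq_0_iff)

lemma cring_complex_ring: "cring complex_ring"
  by (rule cringI[OF abelian_groupI comm_monoidI])
     (auto simp: complex_ring_def algebra_simps intro: exI[of _ "- x" for x])

lemma algebra_trunc_alg:
  assumes "2 \<le> n"
  shows "algebra complex_ring (trunc_alg n)"
proof (rule algebraI[OF cring_complex_ring])
  show "cring (trunc_alg n)"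
  proof (rule cringI[OF abelian_groupI comm_monoidI])
    fix f assume "f \<in> carrier (trunc_alg n)"
    then show "\<exists>g\<in>carrier (trunc_alg n). g \<oplus>\<^bsub>trunc_alg n\<^esub> f = \<zero>\<^bsub>trunc_alg n\<^esub>"
      by (intro bexI[of _ "- f"]) (auto simp: trunc_alg_def)
  qed (use assms in \<open>auto simp: trunc_alg_def degree_add_less degree_mod_monom_less
         mod_poly_less degree_monom_eq mod_mult_left_eq mod_mult_right_eq poly_mod_add_left
         algebra_simps\<close>)
qed (use assms in \<open>auto simp: trunc_alg_def complex_ring_def smult_add_left smult_add_right
       mod_smult_left intro: le_less_trans[OF degree_smult_le]\<close>)

lemma rho_power_trunc_alg:
  assumes "2 \<le> n"
  shows "monom 1 1 [^]\<^bsub>trunc_alg n\<^esub> (k::nat) = (if k < n then monom 1 k else 0)"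
proof (induction k)
  case 0
  then show ?case using assms by (simp add: nat_pow_def trunc_alg_def)
next
  case (Suc k)
  have "monom 1 (Suc k) mod monom (1::complex) n = (if Suc k < n then monom 1 (Suc k) else 0)"
    if "k < n"
  proof (cases "Suc k = n")
    case False
    with that have "Suc k < n" by simp
    then show ?thesis by (simp add: mod_poly_less degree_monom_eq)
  qed auto
  with Suc show ?case
    by (auto simp: nat_pow_def trunc_alg_def mult_monom)
qed

text \<open>A vector \<open>\<Sum>r. c r * rho ^ r\<close> on the sequence of extensions is given by its coefficient
  sequence \<open>c\<close>.\<close>

definition truncation :: "nat \<Rightarrow> (nat \<Rightarrow> complex) \<Rightarrow> complex poly" where
  "truncation n c = (\<Sum>r<n. monom (c r) r)"

definition multi_indices :: "nat \<Rightarrow> ('d::finite \<Rightarrow> nat) set" where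
  "multi_indices k = {\<alpha>. (\<Sum>j\<in>UNIV. \<alpha> j) = k}"

lemma finite_multi_indices: "finite (multi_indices k :: ('d::finite \<Rightarrow> nat) set)"
proof (rule finite_subset)
  show "multi_indices k \<subseteq> (UNIV :: 'd set) \<rightarrow>\<^sub>E {..k}"
    by (auto simp: multi_indices_def PiE_UNIV_domain intro: member_le_sum)
qed (auto intro: finite_PiE)

definition partial_deriv :: "'d::finite \<Rightarrow> (real ^ 'd \<Rightarrow> complex) \<Rightarrow> real ^ 'd \<Rightarrow> complex" where
  "partial_deriv j u x = vector_derivative (\<lambda>h::real. u (x + h *\<^sub>R axis j 1)) (at 0)"

text \<open>The order of the index type fixes the order in which the derivatives are taken: the one
  with respect to the last variable is applied first.\<close>

definition multi_deriv ::
  "('d::{finite,linorder} \<Rightarrow> nat) \<Rightarrow> ((real, 'd) vec \<Rightarrow> complex) \<Rightarrow> (real, 'd) vec \<Rightarrow> complex" where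
  "multi_deriv \<alpha> u = foldr (\<lambda>j. partial_deriv j ^^ \<alpha> j) (sorted_list_of_set UNIV) u"

text \<open>\<open>vector_derivative\<close> is total, so the existence (and continuity) of the partial derivatives
  that occur in the equation is demanded separately.\<close>

primrec C_times :: "nat \<Rightarrow> (real ^ 'd::finite \<Rightarrow> complex) \<Rightarrow> bool" where
  "C_times 0 u \<longleftrightarrow> continuous_on UNIV u"
| "C_times (Suc k) u \<longleftrightarrow> continuous_on UNIV u \<and>
     (\<forall>j. (\<forall>x. (\<lambda>h::real. u (x + h *\<^sub>R axis j 1)) differentiable (at 0)) \<and>
          C_times k (partial_deriv j u))"

definition pde_operator ::
  "nat \<Rightarrow> (nat \<Rightarrow> ('d::{finite,linorder} \<Rightarrow> nat) \<Rightarrow> real) \<Rightarrow>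
     ((real, 'd) vec \<Rightarrow> complex) \<Rightarrow> (real, 'd) vec \<Rightarrow> complex" where
  "pde_operator p C u x =
     (\<Sum>k=0..p. \<Sum>\<alpha>\<in>multi_indices k. of_real (C k \<alpha>) * multi_deriv \<alpha> u x)"

definition pde_solution ::
  "nat \<Rightarrow> (nat \<Rightarrow> ('d::{finite,linorder} \<Rightarrow> nat) \<Rightarrow> real) \<Rightarrow> ((real, 'd) vec \<Rightarrow> complex) \<Rightarrow> bool" where
  "pde_solution p C u \<longleftrightarrow> C_times p u \<and> (\<forall>x. pde_operator p C u x = 0)"

definition char_poly_value ::
  "nat \<Rightarrow> (nat \<Rightarrow> ('d::finite \<Rightarrow> nat) \<Rightarrow> real) \<Rightarrow>
     (complex, 'b) module \<Rightarrow> ('d \<Rightarrow> 'b) \<Rightarrow> 'b" where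
  "char_poly_value p C M e =
     (\<Oplus>\<^bsub>M\<^esub>k\<in>{0..p}. \<Oplus>\<^bsub>M\<^esub>\<alpha>\<in>multi_indices k.
        of_real (C k \<alpha>) \<odot>\<^bsub>M\<^esub> (\<Otimes>\<^bsub>M\<^esub>j\<in>UNIV. e j [^]\<^bsub>M\<^esub> \<alpha> j))"

definition char_eq_on_sequence ::
  "nat \<Rightarrow> (nat \<Rightarrow> ('d::finite \<Rightarrow> nat) \<Rightarrow> real) \<Rightarrow> ('d \<Rightarrow> nat \<Rightarrow> complex) \<Rightarrow> bool" where
  "char_eq_on_sequence p C a \<longleftrightarrow>
     (\<forall>n\<ge>2. char_poly_value p C (trunc_alg n) (\<lambda>j. truncation n (a j)) = \<zero>\<^bsub>trunc_alg n\<^esub>)"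

text \<open>The sequence \<open>\<xi>\<close> collects the quantities \<open>\<xi> = \<xi> 0\<close> and \<open>\<xi>\<^sub>r = \<xi> r\<close> for \<open>r \<ge> 1\<close>.\<close>

fun A_fun :: "(nat \<Rightarrow> complex) \<Rightarrow> nat \<Rightarrow> complex \<Rightarrow> complex" where
  "A_fun \<xi> 0 t = 1 / (t - \<xi> 0)"
| "A_fun \<xi> (Suc s) t = 1 / (t - \<xi> 0) * (\<Sum>i\<le>s. \<xi> (Suc s - i) * A_fun \<xi> i t)"

text \<open>\<open>Q_coeff \<xi> r s\<close> is the value \<open>Q\<^sub>r\<^sub>,\<^sub>s(\<xi>\<^sub>1, \<dots>, \<xi>\<^sub>r)\<close> for \<open>r \<ge> 1\<close>, and \<open>0\<close> unless \<open>2 \<le> s \<le> r + 1\<close>.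
  Lemma \<open>Q_coeff_unique\<close> below states that the description is proper, and \<open>Q_coeff_1\<close> and
  \<open>Q_coeff_Suc\<close> exhibit the values as polynomials in \<open>\<xi>\<^sub>1, \<dots>, \<xi>\<^sub>r\<close>.\<close>

definition Q_coeff :: "(nat \<Rightarrow> complex) \<Rightarrow> nat \<Rightarrow> nat \<Rightarrow> complex" where
  "Q_coeff \<xi> r = (THE c. (\<forall>s. s \<notin> {2..r+1} \<longrightarrow> c s = 0) \<and>
     (\<forall>t. t \<noteq> \<xi> 0 \<longrightarrow> A_fun \<xi> r t = (\<Sum>s=2..r+1. c s / (t - \<xi> 0) ^ s)))"

definition Psi :: "(nat \<Rightarrow> complex) \<Rightarrow> nat \<Rightarrow> complex" where
  "Psi \<xi> r = (if r = 0 then 1 else \<Sum>s=2..r+1. Q_coeff \<xi> r s / fact (s - 1))"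

fun A_poly :: "(nat \<Rightarrow> complex) \<Rightarrow> nat \<Rightarrow> complex poly" where
  "A_poly \<xi> 0 = [:0, 1:]"
| "A_poly \<xi> (Suc s) = pCons 0 (\<Sum>i\<le>s. Polynomial.smult (\<xi> (Suc s - i)) (A_poly \<xi> i))"

lemma A_fun_eq_poly: "A_fun \<xi> r t = poly (A_poly \<xi> r) (1 / (t - \<xi> 0))"
proof (induction r rule: less_induct)
  case (less r)
  then show ?case by (cases r) (simp_all add: poly_sum)
qed

lemma coeff_A_poly_0: "coeff (A_poly \<xi> r) 0 = 0"
  by (cases r) auto

lemma coeff_A_poly_1: "r > 0 \<Longrightarrow> coeff (A_poly \<xi> r) (Suc 0) = 0"
  by (cases r) (auto simp: coeff_sum coeff_A_poly_0)

lemma coeff_A_poly_big: "s > r + 1 \<Longrightarrow> coeff (A_poly \<xi> r) s = 0"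
proof (induction r arbitrary: s rule: less_induct)
  case (less r)
  then show ?case
    by (cases r; cases s) (auto simp: coeff_sum coeff_pCons split: nat.splits intro!: sum.neutral)
qed

lemma coeff_A_poly_outside: "r \<ge> 1 \<Longrightarrow> s \<notin> {2..r+1} \<Longrightarrow> coeff (A_poly \<xi> r) s = 0"
  using coeff_A_poly_0[of \<xi> r] coeff_A_poly_1[of r \<xi>] coeff_A_poly_big[of r s \<xi>]
  by (cases "s = 0"; cases "s = 1") auto

lemma A_fun_expansion:
  assumes "r \<ge> 1"
  shows "A_fun \<xi> r t = (\<Sum>s=2..r+1. coeff (A_poly \<xi> r) s / (t - \<xi> 0) ^ s)"
proof -
  have "A_fun \<xi> r t = (\<Sum>s\<le>degree (A_poly \<xi> r). coeff (A_poly \<xi> r) s * (1 / (t - \<xi> 0)) ^ s)"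
    by (simp only: A_fun_eq_poly poly_altdef)
  also have "\<dots> = (\<Sum>s=2..r+1. coeff (A_poly \<xi> r) s * (1 / (t - \<xi> 0)) ^ s)"
  proof (rule sum.mono_neutral_cong)
    fix s assume "s \<in> {..degree (A_poly \<xi> r)} - {2..r+1}"
    then show "coeff (A_poly \<xi> r) s * (1 / (t - \<xi> 0)) ^ s = 0"
      using coeff_A_poly_outside[OF assms, of s \<xi>] by simp
  next
    fix s assume "s \<in> {2..r+1} - {..degree (A_poly \<xi> r)}"
    then show "coeff (A_poly \<xi> r) s * (1 / (t - \<xi> 0)) ^ s = 0"
      by (simp add: coeff_eq_0)
  qed simp_all
  finally show ?thesis by (simp add: power_one_over field_simps)
qed

lemma Q_coeff_unique_aux:
  fixes c c' :: "nat \<Rightarrow> complex"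
  assumes "\<And>t. t \<noteq> z \<Longrightarrow> (\<Sum>s=2..m. c s / (t - z) ^ s) = (\<Sum>s=2..m. c' s / (t - z) ^ s)"
    and "s \<in> {2..m}"
  shows "c s = c' s"
proof -
  define q where "q = (\<Sum>s=2..m. monom (c s - c' s) s)"
  have "poly q w = 0" if "w \<noteq> 0" for w
    using assms(1)[of "z + 1 / w"] that
    by (simp add: q_def poly_sum poly_monom field_simps sum_subtractf power_divide)
  then have "UNIV - {0} \<subseteq> {w. poly q w = 0}" by auto
  moreover have "infinite (UNIV - {0::complex})"
    by (simp add: infinite_UNIV_char_0)
  ultimately have "q = 0" using poly_roots_finite finite_subset by blast
  then have "coeff q s = 0" by simp
  then show ?thesis using assms(2) by (simp add: q_def coeff_sum)
qed

lemma Q_coeff_unique: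
  assumes "r \<ge> 1"
  shows "\<exists>!c. (\<forall>s. s \<notin> {2..r+1} \<longrightarrow> c s = 0) \<and>
     (\<forall>t. t \<noteq> \<xi> 0 \<longrightarrow> A_fun \<xi> r t = (\<Sum>s=2..r+1. c s / (t - \<xi> 0) ^ s))"
proof (rule ex1I)
  show "(\<forall>s. s \<notin> {2..r+1} \<longrightarrow> coeff (A_poly \<xi> r) s = 0) \<and>
     (\<forall>t. t \<noteq> \<xi> 0 \<longrightarrow> A_fun \<xi> r t = (\<Sum>s=2..r+1. coeff (A_poly \<xi> r) s / (t - \<xi> 0) ^ s))"
    using A_fun_expansion[OF assms] coeff_A_poly_outside[OF assms] by blast
next
  fix c assume c: "(\<forall>s. s \<notin> {2..r+1} \<longrightarrow> c s = 0) \<and>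
     (\<forall>t. t \<noteq> \<xi> 0 \<longrightarrow> A_fun \<xi> r t = (\<Sum>s=2..r+1. c s / (t - \<xi> 0) ^ s))"
  show "c = coeff (A_poly \<xi> r)"
  proof
    fix s
    show "c s = coeff (A_poly \<xi> r) s"
    proof (cases "s \<in> {2..r+1}")
      case True
      show ?thesis
        by (rule Q_coeff_unique_aux[OF _ True, of "\<xi> 0"])
           (use c A_fun_expansion[OF assms, of \<xi>] in auto)
    next
      case False
      then show ?thesis using c coeff_A_poly_outside[OF assms] by auto
    qed
  qed
qed

lemma Q_coeff_eq:
  assumes "r \<ge> 1"
  shows "Q_coeff \<xi> r = coeff (A_poly \<xi> r)"
  unfolding Q_coeff_def
  by (rule the1_equality[OF Q_coeff_unique[OF assms]])
     (use A_fun_expansion[OF assms] coeff_A_poly_outside[OF assms] in blast)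

lemma Q_coeff_1: "Q_coeff \<xi> 1 s = (if s = 2 then \<xi> 1 else 0)"
  by (auto simp: Q_coeff_eq coeff_pCons numeral_2_eq_2 split: nat.splits)

lemma Q_coeff_Suc:
  assumes "r \<ge> 1"
  shows "Q_coeff \<xi> (Suc r) (Suc s) =
    (if s = 1 then \<xi> (Suc r) else 0) + (\<Sum>i=1..r. \<xi> (Suc r - i) * Q_coeff \<xi> i s)"
proof -
  have "{..r} = insert 0 {1..r}" by auto
  then show ?thesis
    by (auto simp: Q_coeff_eq coeff_sum coeff_pCons split: nat.splits)
qed

lemma Psi_examples:
  "Psi \<xi> 1 = \<xi> 1"
  "Psi \<xi> 2 = \<xi> 2 + \<xi> 1 ^ 2 / 2"
  "Psi \<xi> 3 = \<xi> 3 + \<xi> 1 * \<xi> 2 + \<xi> 1 ^ 3 / fact 3"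
  by (auto simp: Psi_def Q_coeff_eq numeral_2_eq_2 numeral_3_eq_3 coeff_sum field_simps)

definition xi :: "('d::finite \<Rightarrow> nat \<Rightarrow> complex) \<Rightarrow> real ^ 'd \<Rightarrow> nat \<Rightarrow> complex" where
  "xi a x r = (\<Sum>j\<in>UNIV. of_real (x $ j) * a j r)"

definition V :: "('d::finite \<Rightarrow> nat \<Rightarrow> complex) \<Rightarrow> nat \<Rightarrow> real ^ 'd \<Rightarrow> complex" where
  "V a r x = Psi (xi a x) r * exp (xi a x 0)"

end

theory Submission
  imports Defs
begin

text \<open>
  Put \<open>e(x) = \<Sum>j. x\<^sub>j e\<^sub>j = \<xi> + \<eta>\<close> with \<open>\<eta> = \<Sum>r\<ge>1. \<xi>\<^sub>r \<rho>\<^sup>r\<close>, a formal power series in \<open>\<rho>\<close>. The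
  recursion for \<open>A\<^sub>r\<close> says that \<open>\<Sum>r. A\<^sub>r \<rho>\<^sup>r\<close> is the resolvent
  \<open>1 / (t - e(x)) = \<Sum>k. \<eta>\<^sup>k / (t - \<xi>)\<^bsup>k+1\<^esup>\<close>, and the operator \<open>P\<close> turns \<open>1 / (t - \<xi>)\<^bsup>k+1\<^esup>\<close> into
  \<open>1 / k!\<close>. So \<open>\<Sum>r. \<Psi>\<^sub>r \<rho>\<^sup>r = exp \<eta>\<close> (lemma \<open>Psi_eq_exp_nth\<close>), and the generating series of the
  functions \<open>V\<^sub>r\<close> is \<open>G(x) = exp e(x)\<close>.

  Differentiating \<open>G\<close> along a vector \<open>v\<close> multiplies it by \<open>e(v)\<close> (lemma \<open>has_derivative_V\<close>); along
  the \<open>j\<close>-th axis the factor is \<open>e\<^sub>j\<close>. The operator \<open>E\<close> therefore multiplies \<open>G\<close> by the value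
  of the characteristic polynomial at \<open>(e\<^sub>1, \<dots>, e\<^sub>d)\<close>, computed in the ring of power series
  (lemma \<open>pde_operator_V\<close>). Truncating power series at \<open>\<rho>\<^sup>n\<close> is a homomorphism onto the algebra in
  which \<open>\<rho>\<^sup>n = 0\<close>, so the characteristic equation on the sequence of extensions kills every
  coefficient of this value (lemma \<open>char_series_eq_0\<close>).
\<close>

section \<open>The exponential generating series of the polynomials \<open>\<Psi>\<^sub>r\<close>\<close>

text \<open>This is \<open>\<eta>\<close> above; its image in each algebra with \<open>\<rho>\<^sup>n = 0\<close> is nilpotent. The constant
  term is split off because it enters \<open>V\<^sub>r\<close> through the complex exponential, while a series without
  constant term can be substituted into the formal
  exponential series.\<close>

definition nilpotent_part :: "(nat \<Rightarrow> complex) \<Rightarrow> complex fps" where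
  "nilpotent_part \<xi> = Abs_fps (\<lambda>r. if r = 0 then 0 else \<xi> r)"

lemma nilpotent_part_nth:
  "fps_nth (nilpotent_part \<xi>) r = (if r = 0 then 0 else \<xi> r)"
  by (simp add: nilpotent_part_def)

lemma Abs_fps_eq_const_plus_nilpotent_part:
  "Abs_fps \<xi> = fps_const (\<xi> 0) + nilpotent_part \<xi>"
  by (rule fps_ext) (simp add: nilpotent_part_nth)

lemma nilpotent_part_power_nth_eq_0:
  "r < k \<Longrightarrow> fps_nth (nilpotent_part \<xi> ^ k) r = 0"
  by (rule startsby_zero_power_prefix[rule_format]) (auto simp: nilpotent_part_nth)

text \<open>The resolvent expansion: \<open>A_poly \<xi> r\<close> is \<open>A\<^sub>r\<close> written in the variable \<open>w = 1 / (t - \<xi>)\<close>, and the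
  geometric series gives \<open>\<Sum>r. A\<^sub>r \<rho>\<^sup>r = w / (1 - w \<eta>) = \<Sum>k. w\<^bsup>k+1\<^esup> \<eta>\<^sup>k\<close>. The induction is on the power
  of \<open>w\<close>, since the recursion for \<open>A\<^sub>r\<close> is a Cauchy product with \<open>\<eta>\<close> that raises it by one.\<close>

lemma coeff_A_poly_eq_power_nth:
  "coeff (A_poly \<xi> r) (Suc k) = fps_nth (nilpotent_part \<xi> ^ k) r"
proof (induction k arbitrary: r)
  case 0
  then show ?case
    using coeff_A_poly_1[of r \<xi>] by (cases r) auto
next
  case (Suc k)
  show ?case
  proof (cases r)
    case 0
    then show ?thesis by (simp add: nilpotent_part_nth)
  next
    case r: (Suc s)
    have "coeff (A_poly \<xi> r) (Suc (Suc k)) =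
        (\<Sum>i\<le>s. \<xi> (Suc s - i) * fps_nth (nilpotent_part \<xi> ^ k) i)"
      by (simp add: r coeff_sum Suc)
    \<comment> \<open>The new summand at \<open>i = Suc s\<close> vanishes, because \<open>\<eta>\<close> has no constant term.\<close>
    also have "\<dots> = (\<Sum>i\<le>Suc s. fps_nth (nilpotent_part \<xi> ^ k) i
        * fps_nth (nilpotent_part \<xi>) (Suc s - i))"
      by (simp add: nilpotent_part_nth mult.commute)
    also have "\<dots> = fps_nth (nilpotent_part \<xi> ^ k * nilpotent_part \<xi>) r"
      by (simp add: fps_mult_nth r atMost_atLeast0)
    finally show ?thesis by (simp add: mult.commute)
  qed
qed

lemma Psi_eq_exp_nth: "Psi \<xi> r = fps_nth (fps_exp 1 oo nilpotent_part \<xi>) r"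
proof (cases "r = 0")
  case True
  then show ?thesis by (simp add: Psi_def fps_compose_nth)
next
  case False
  have "Psi \<xi> r = (\<Sum>s=Suc 1..Suc r. coeff (A_poly \<xi> r) s / fact (s - 1))"
    using False by (simp add: Psi_def Q_coeff_eq numeral_2_eq_2)
  also have "\<dots> = (\<Sum>k=1..r. fps_nth (nilpotent_part \<xi> ^ k) r / fact k)"
    unfolding sum.shift_bounds_cl_Suc_ivl by (simp add: coeff_A_poly_eq_power_nth)
  also have "\<dots> = (\<Sum>k=0..r. fps_nth (nilpotent_part \<xi> ^ k) r / fact k)"
    using False by (simp add: sum.atLeast_Suc_atMost)
  finally show ?thesis by (simp add: fps_compose_nth)
qed

text \<open>The sum is finite with a bound that depends only on the coefficient sought: powers \<open>b ^ i\<close> with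
  \<open>i > r\<close> do not reach order \<open>r\<close>. This allows one to differentiate a composed series termwise
  without any question of convergence.\<close>

lemma fps_compose_mult_nth:
  fixes f b w :: "complex fps"
  assumes "fps_nth b 0 = 0"
  shows "fps_nth ((f oo b) * w) r = (\<Sum>i\<le>r. fps_nth f i * fps_nth (b ^ i * w) r)"
proof -
  have "fps_nth (b ^ i) s = 0" if "s < i" for i s
    using startsby_zero_power_prefix[OF assms] that by blast
  then have "fps_nth (f oo b) s = (\<Sum>i\<le>r. fps_nth f i * fps_nth (b ^ i) s)" if "s \<le> r" for s
    unfolding fps_compose_nth
    by (intro sum.mono_neutral_left) (use that in auto)
  then have "fps_nth ((f oo b) * w) r =
      (\<Sum>s\<le>r. \<Sum>i\<le>r. fps_nth f i * (fps_nth (b ^ i) s * fps_nth w (r - s)))"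
    by (simp add: fps_mult_nth atLeast0AtMost sum_distrib_right mult.assoc)
  also have "\<dots> = (\<Sum>i\<le>r. \<Sum>s\<le>r. fps_nth f i * (fps_nth (b ^ i) s * fps_nth w (r - s)))"
    by (rule sum.swap)
  finally show ?thesis
    by (simp add: fps_mult_nth atLeast0AtMost sum_distrib_left)
qed

section \<open>Differentiation of the functions \<open>V\<^sub>r\<close>\<close>

text \<open>A function with values in power series is differentiated coefficientwise. A coefficient of a
  product is a finite sum of products, so the Leibniz rule carries over.\<close>

lemma has_derivative_fps_mult_nth:
  fixes F G F' G' :: "_ \<Rightarrow> complex fps"
  assumes "\<And>n. ((\<lambda>x. fps_nth (F x) n) has_derivative (\<lambda>v. fps_nth (F' v) n)) (at x)"
    and "\<And>n. ((\<lambda>x. fps_nth (G x) n) has_derivative (\<lambda>v. fps_nth (G' v) n)) (at x)"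
  shows "((\<lambda>x. fps_nth (F x * G x) n) has_derivative
           (\<lambda>v. fps_nth (F x * G' v + F' v * G x) n)) (at x)"
  unfolding fps_mult_nth fps_add_nth
  by (rule derivative_eq_intros assms refl | simp add: sum.distrib)+

text \<open>\<open>\<xi>\<^sub>n\<close> is linear in \<open>x\<close> and hence its own derivative.\<close>

lemma has_derivative_xi:
  fixes a :: "'d::finite \<Rightarrow> nat \<Rightarrow> complex"
  shows "((\<lambda>x. xi a x n) has_derivative (\<lambda>v. xi a v n)) (at x)"
  unfolding xi_def
  by (rule derivative_eq_intros refl bounded_linear.has_derivative[OF bounded_linear_vec_nth]
     | simp)+

lemma has_derivative_nilpotent_part_power:
  fixes a :: "'d::finite \<Rightarrow> nat \<Rightarrow> complex"
  shows "((\<lambda>x. fps_nth (nilpotent_part (xi a x) ^ k) n) has_derivative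
     (\<lambda>v. fps_nth (of_nat k * nilpotent_part (xi a x) ^ (k - 1) * nilpotent_part (xi a v)) n))
     (at x)"
proof (induction k arbitrary: n)
  case 0
  then show ?case by simp
next
  case (Suc k)
  have 1: "((\<lambda>x. fps_nth (nilpotent_part (xi a x)) n) has_derivative
      (\<lambda>v. fps_nth (nilpotent_part (xi a v)) n)) (at x)" for n
    by (cases "n = 0") (simp_all add: nilpotent_part_nth has_derivative_xi)
  have 2: "nilpotent_part (xi a x) *
        (of_nat k * nilpotent_part (xi a x) ^ (k - 1) * nilpotent_part (xi a v)) +
      nilpotent_part (xi a v) * nilpotent_part (xi a x) ^ k =
      of_nat (Suc k) * nilpotent_part (xi a x) ^ (Suc k - 1) * nilpotent_part (xi a v)" for v
    by (cases k) (simp_all add: algebra_simps)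
  show ?case
    using has_derivative_fps_mult_nth[OF 1 Suc, of n] by (simp only: 2 power_Suc)
qed

text \<open>The chain rule for \<open>exp \<eta>\<close>: the derivative of \<open>\<eta>\<^sup>i / i!\<close> is \<open>\<eta>\<^bsup>i-1\<^esup> / (i - 1)!\<close> times that of \<open>\<eta>\<close>.\<close>

lemma has_derivative_Psi:
  fixes a :: "'d::finite \<Rightarrow> nat \<Rightarrow> complex"
  shows "((\<lambda>x. Psi (xi a x) r) has_derivative
     (\<lambda>v. fps_nth (nilpotent_part (xi a v) * Abs_fps (Psi (xi a x))) r)) (at x)"
proof -
  let ?\<eta> = "\<lambda>x. nilpotent_part (xi a x)"
  have "fps_nth (?\<eta> v * Abs_fps (Psi (xi a x))) r =
      (\<Sum>i=0..r. 1 / fact i * fps_nth (of_nat i * ?\<eta> x ^ (i - 1) * ?\<eta> v) r)" for v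
  proof -
    have "Abs_fps (Psi (xi a x)) = fps_exp 1 oo ?\<eta> x"
      by (rule fps_ext) (simp add: Psi_eq_exp_nth)
    then have "fps_nth (?\<eta> v * Abs_fps (Psi (xi a x))) r =
        (\<Sum>i\<le>r. 1 / fact i * fps_nth (?\<eta> x ^ i * ?\<eta> v) r)"
      by (simp add: mult.commute[of "?\<eta> v"] fps_compose_mult_nth nilpotent_part_nth)
    \<comment> \<open>The top term can be dropped since \<open>\<eta>\<^sup>r \<eta>(v)\<close> has order at least \<open>r + 1\<close>; this makes room for
      the shift of the summation index.\<close>
    also have "\<dots> = (\<Sum>i<r. 1 / fact i * fps_nth (?\<eta> x ^ i * ?\<eta> v) r)"
    proof -
      have "fps_nth (?\<eta> x ^ r * ?\<eta> v) r = 0"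
        unfolding fps_mult_nth
        by (rule sum.neutral)
           (auto simp: nilpotent_part_nth nilpotent_part_power_nth_eq_0)
      then show ?thesis
        by (simp add: lessThan_Suc_atMost[symmetric])
    qed
    also have "\<dots> = (\<Sum>i<r. 1 / fact (Suc i) *
        fps_nth (of_nat (Suc i) * (?\<eta> x ^ i * ?\<eta> v)) r)"
      by (rule sum.cong) (simp_all del: of_nat_Suc add: fps_of_nat[symmetric] field_simps)
    also have "\<dots> = (\<Sum>i=0..r. 1 / fact i * fps_nth (of_nat i * ?\<eta> x ^ (i - 1) * ?\<eta> v) r)"
      by (simp del: sum.lessThan_Suc of_nat_Suc fact_Suc
          add: atLeast0AtMost lessThan_Suc_atMost[symmetric] sum.lessThan_Suc_shift mult.assoc)
    finally show ?thesis .
  qed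
  moreover have "((\<lambda>x. Psi (xi a x) r) has_derivative
      (\<lambda>v. \<Sum>i=0..r. 1 / fact i * fps_nth (of_nat i * ?\<eta> x ^ (i - 1) * ?\<eta> v) r)) (at x)"
    unfolding Psi_eq_exp_nth fps_compose_nth fps_exp_nth power_one of_nat_fact
    by (intro has_derivative_sum has_derivative_mult_right
        has_derivative_nilpotent_part_power)
  ultimately show ?thesis by simp
qed

text \<open>The derivative of \<open>exp e(x)\<close> in direction \<open>v\<close> is \<open>e(v) exp e(x)\<close>. The summand \<open>\<xi>(v)\<close> of \<open>e(v)\<close>
  comes from the factor \<open>exp \<xi>\<close>, the summand \<open>\<eta>(v)\<close> from the factor \<open>exp \<eta>\<close>.\<close>

lemma has_derivative_V:
  fixes a :: "'d::finite \<Rightarrow> nat \<Rightarrow> complex"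
  shows "(V a r has_derivative
     (\<lambda>v. fps_nth (Abs_fps (xi a v) * Abs_fps (\<lambda>s. V a s x)) r)) (at x)"
proof -
  have "Abs_fps (\<lambda>s. V a s x) = fps_const (exp (xi a x 0)) * Abs_fps (Psi (xi a x))"
    by (rule fps_ext) (simp add: V_def mult.commute)
  then have "fps_nth (Abs_fps (xi a v) * Abs_fps (\<lambda>s. V a s x)) r =
      Psi (xi a x) r * (exp (xi a x 0) * xi a v 0) +
      fps_nth (nilpotent_part (xi a v) * Abs_fps (Psi (xi a x))) r * exp (xi a x 0)" for v
    by (simp add: Abs_fps_eq_const_plus_nilpotent_part[of "xi a v"] distrib_right
        mult.left_commute[of "nilpotent_part _" "fps_const _"])
  moreover have "((\<lambda>x. exp (xi a x 0)) has_derivative (\<lambda>v. exp (xi a x 0) * xi a v 0)) (at x)"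
    using has_derivative_compose[OF has_derivative_xi
        DERIV_exp[unfolded has_field_derivative_def]] .
  ultimately show ?thesis
    unfolding V_def[abs_def] using has_derivative_mult[OF has_derivative_Psi] by simp
qed

text \<open>The linear combinations \<open>\<Sum>s\<le>r. f\<^sub>s V\<^sub>r\<^sub>-\<^sub>s\<close> form a family that is closed under partial
  derivatives: \<open>\<partial>\<^sub>j\<close> only multiplies \<open>f\<close> by \<open>e\<^sub>j\<close>. Both iterated derivatives and regularity
  follow by induction within this family, starting from \<open>V\<^sub>r\<close>, which is the case \<open>f = 1\<close>.\<close>

definition fps_action ::
    "('d::finite \<Rightarrow> nat \<Rightarrow> complex) \<Rightarrow> complex fps \<Rightarrow> nat \<Rightarrow> real ^ 'd \<Rightarrow> complex" where
  "fps_action a f r x = fps_nth (f * Abs_fps (\<lambda>s. V a s x)) r"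

lemma has_derivative_fps_action:
  "(fps_action a f r has_derivative (\<lambda>v. fps_action a (f * Abs_fps (xi a v)) r x)) (at x)"
  using has_derivative_fps_mult_nth[of "\<lambda>_. f" "\<lambda>_. 0" x
      "\<lambda>x. Abs_fps (\<lambda>s. V a s x)" "\<lambda>v. Abs_fps (xi a v) * Abs_fps (\<lambda>s. V a s x)" r]
    has_derivative_V[of a _ x]
  by (simp add: fps_action_def[abs_def] mult.assoc)

lemma xi_axis: "xi a (axis j 1) = a j"
proof
  fix r
  have "xi a (axis j 1) r = (\<Sum>i\<in>UNIV. if i = j then a i r else 0)"
    unfolding xi_def by (rule sum.cong) (auto simp: axis_def)
  then show "xi a (axis j 1) r = a j r" by simp
qed

lemma has_vector_derivative_fps_action:
  "((\<lambda>h::real. fps_action a f r (x + h *\<^sub>R axis j 1)) has_vector_derivative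
     fps_action a (f * Abs_fps (a j)) r x) (at 0)"
proof -
  have line: "((\<lambda>h::real. x + h *\<^sub>R axis j 1) has_vector_derivative axis j 1) (at 0)"
    by (auto intro!: derivative_eq_intros)
  have der: "(fps_action a f r has_derivative (\<lambda>v. fps_action a (f * Abs_fps (xi a v)) r x))
      (at (x + 0 *\<^sub>R axis j 1))"
    using has_derivative_fps_action by simp
  show ?thesis
    using vector_derivative_diff_chain_within[OF line has_derivative_at_withinI[OF der]]
    by (simp add: o_def xi_axis)
qed

lemma partial_deriv_fps_action:
  "partial_deriv j (fps_action a f r) = fps_action a (f * Abs_fps (a j)) r"
  unfolding partial_deriv_def
  by (rule ext) (rule vector_derivative_at[OF has_vector_derivative_fps_action])

lemma partial_deriv_power_fps_action:
  "(partial_deriv j ^^ k) (fps_action a f r) = fps_action a (f * Abs_fps (a j) ^ k) r"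
  by (induction k) (simp_all add: partial_deriv_fps_action algebra_simps)

text \<open>The order of the derivatives disappears because multiplication of power series is
  commutative.\<close>

lemma multi_deriv_fps_action:
  fixes a :: "'d::{finite,linorder} \<Rightarrow> nat \<Rightarrow> complex"
  shows "multi_deriv \<alpha> (fps_action a f r) = fps_action a (f * (\<Prod>j\<in>UNIV. Abs_fps (a j) ^ \<alpha> j)) r"
proof -
  have "foldr (\<lambda>j. partial_deriv j ^^ \<alpha> j) js (fps_action a f r) =
      fps_action a (f * prod_list (map (\<lambda>j. Abs_fps (a j) ^ \<alpha> j) js)) r" for js
    by (induction js) (simp_all add: partial_deriv_power_fps_action algebra_simps)
  moreover have "prod_list (map g (sorted_list_of_set UNIV)) = (\<Prod>j\<in>UNIV. g j)"
    for g :: "'d \<Rightarrow> complex fps"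
    using prod.distinct_set_conv_list[of "sorted_list_of_set UNIV" g] by simp
  ultimately show ?thesis by (simp add: multi_deriv_def)
qed

lemma C_times_fps_action: "C_times k (fps_action a f r)"
proof (induction k arbitrary: f)
  case 0
  then show ?case
    by (auto intro: continuous_at_imp_continuous_on has_derivative_continuous
        has_derivative_fps_action)
next
  case (Suc k)
  then show ?case
    by (auto intro: continuous_at_imp_continuous_on has_derivative_continuous
        has_derivative_fps_action differentiableI_vector has_vector_derivative_fps_action
        simp: partial_deriv_fps_action)
qed

section \<open>The characteristic equation in the ring of power series\<close>

definition fps_truncation :: "nat \<Rightarrow> complex fps \<Rightarrow> complex poly" where
  "fps_truncation n f = truncation n (fps_nth f)"

lemma truncation_eq_fps_truncation: "truncation n c = fps_truncation n (Abs_fps c)"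
  by (simp add: fps_truncation_def Abs_fps_inverse)

lemma coeff_fps_truncation:
  "coeff (fps_truncation n f) r = (if r < n then fps_nth f r else 0)"
  by (simp add: fps_truncation_def truncation_def coeff_sum)

lemma degree_fps_truncation_less: "0 < n \<Longrightarrow> degree (fps_truncation n f) < n"
  by (rule degree_lessI) (auto simp: coeff_fps_truncation)

lemma coeff_mod_monom:
  fixes f :: "complex poly"
  assumes "r < n"
  shows "coeff (f mod monom 1 n) r = coeff f r"
proof -
  have "coeff f r = coeff (monom 1 n * (f div monom 1 n) + f mod monom 1 n) r"
    by simp
  also have "\<dots> = coeff (f mod monom 1 n) r"
    unfolding coeff_add coeff_monom_mult using assms by simp
  finally show ?thesis by simp
qed

text \<open>Reduction modulo \<open>\<rho>\<^sup>n\<close> changes no coefficient below \<open>n\<close>, and those of a Cauchy product involve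
  only coefficients of the factors below \<open>n\<close>. With the analogous facts below, truncation is a
  homomorphism of algebras.\<close>

lemma fps_truncation_mult:
  assumes "0 < n"
  shows "fps_truncation n f \<otimes>\<^bsub>trunc_alg n\<^esub> fps_truncation n g =
    fps_truncation n (f * g)"
proof -
  have "coeff ((fps_truncation n f * fps_truncation n g) mod monom 1 n) r =
      coeff (fps_truncation n (f * g)) r" for r
  proof (cases "r < n")
    case True
    then show ?thesis
      by (simp add: coeff_mod_monom coeff_mult coeff_fps_truncation fps_mult_nth atLeast0AtMost
          less_imp_diff_less)
  next
    case False
    then show ?thesis
      using degree_mod_monom_less[OF assms, of "fps_truncation n f * fps_truncation n g"]
      by (simp add: coeff_fps_truncation coeff_eq_0)
  qed
  then show ?thesis by (simp add: trunc_alg_def poly_eq_iff)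
qed

lemma fps_truncation_one: "0 < n \<Longrightarrow> \<one>\<^bsub>trunc_alg n\<^esub> = fps_truncation n 1"
  by (auto simp: trunc_alg_def poly_eq_iff coeff_fps_truncation)

lemma fps_truncation_zero: "\<zero>\<^bsub>trunc_alg n\<^esub> = fps_truncation n 0"
  by (auto simp: trunc_alg_def poly_eq_iff coeff_fps_truncation)

lemma fps_truncation_add:
  "fps_truncation n f \<oplus>\<^bsub>trunc_alg n\<^esub> fps_truncation n g =
    fps_truncation n (f + g)"
  by (auto simp: trunc_alg_def poly_eq_iff coeff_fps_truncation)

lemma fps_truncation_smult:
  "c \<odot>\<^bsub>trunc_alg n\<^esub> fps_truncation n f = fps_truncation n (fps_const c * f)"
  by (auto simp: trunc_alg_def poly_eq_iff coeff_fps_truncation)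

lemma fps_truncation_in_carrier: "0 < n \<Longrightarrow> fps_truncation n f \<in> carrier (trunc_alg n)"
  by (simp add: trunc_alg_def degree_fps_truncation_less)

lemma fps_truncation_power:
  assumes "0 < n"
  shows "fps_truncation n f [^]\<^bsub>trunc_alg n\<^esub> (k::nat) = fps_truncation n (f ^ k)"
  by (induction k)
     (simp_all add: nat_pow_def fps_truncation_one fps_truncation_mult assms mult.commute)

lemma fps_truncation_finsum:
  assumes "2 \<le> n" and "finite I"
  shows "(\<Oplus>\<^bsub>trunc_alg n\<^esub>i\<in>I. fps_truncation n (f i)) =
    fps_truncation n (\<Sum>i\<in>I. f i)"
proof -
  interpret algebra complex_ring "trunc_alg n" by (rule algebra_trunc_alg[OF assms(1)])
  show ?thesis
    using assms(2)
    by induction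
       (use assms(1) in \<open>simp_all add: fps_truncation_zero fps_truncation_add fps_truncation_in_carrier\<close>)
qed

lemma fps_truncation_finprod:
  assumes "2 \<le> n" and "finite I"
  shows "(\<Otimes>\<^bsub>trunc_alg n\<^esub>i\<in>I. fps_truncation n (f i)) =
    fps_truncation n (\<Prod>i\<in>I. f i)"
proof -
  interpret algebra complex_ring "trunc_alg n" by (rule algebra_trunc_alg[OF assms(1)])
  show ?thesis
    using assms(2)
    by induction
       (use assms(1) in \<open>simp_all add: fps_truncation_one fps_truncation_mult fps_truncation_in_carrier\<close>)
qed

text \<open>The value of the characteristic polynomial at the untruncated vectors \<open>e\<^sub>1, \<dots>, e\<^sub>d\<close>.\<close>

definition char_series ::
    "nat \<Rightarrow> (nat \<Rightarrow> ('d::finite \<Rightarrow> nat) \<Rightarrow> real) \<Rightarrow> ('d \<Rightarrow> nat \<Rightarrow> complex) \<Rightarrow> complex fps" where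
  "char_series p C a = (\<Sum>k=0..p. \<Sum>\<alpha>\<in>multi_indices k.
     fps_const (of_real (C k \<alpha>)) * (\<Prod>j\<in>UNIV. Abs_fps (a j) ^ \<alpha> j))"

lemma char_poly_value_trunc_alg:
  assumes "2 \<le> n"
  shows "char_poly_value p C (trunc_alg n) (\<lambda>j. truncation n (a j)) =
    fps_truncation n (char_series p C a)"
proof -
  have "truncation n (a j) [^]\<^bsub>trunc_alg n\<^esub> (k::nat) =
      fps_truncation n (Abs_fps (a j) ^ k)" for j k
    using fps_truncation_power[of n "Abs_fps (a j)" k] assms
    by (simp add: truncation_eq_fps_truncation)
  then show ?thesis
    by (simp add: char_poly_value_def char_series_def assms fps_truncation_finsum fps_truncation_finprod
        fps_truncation_smult finite_multi_indices)
qed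

text \<open>Every coefficient survives in some truncation; the one at \<open>\<rho>\<^sup>r\<close> is visible for \<open>n = r + 2\<close>,
  which is at least \<open>2\<close> for all \<open>r\<close>.\<close>

lemma char_series_eq_0:
  assumes "char_eq_on_sequence p C a"
  shows "char_series p C a = 0"
proof (rule fps_ext)
  fix r
  have "fps_truncation (r + 2) (char_series p C a) = 0"
    using assms char_poly_value_trunc_alg[of "r + 2" p C a]
    by (simp add: char_eq_on_sequence_def trunc_alg_def)
  then have "coeff (fps_truncation (r + 2) (char_series p C a)) r = 0"
    by simp
  then show "fps_nth (char_series p C a) r = fps_nth 0 r"
    by (simp add: coeff_fps_truncation)
qed

section \<open>Solutions of the differential equation\<close>

lemma pde_operator_V:
  fixes C :: "nat \<Rightarrow> ('d::{finite,linorder} \<Rightarrow> nat) \<Rightarrow> real"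
  shows "pde_operator p C (V a r) x = fps_action a (char_series p C a) r x"
proof -
  have "V a r = fps_action a 1 r" by (rule ext) (simp add: fps_action_def)
  then show ?thesis
    by (simp add: pde_operator_def multi_deriv_fps_action char_series_def)
       (simp add: fps_action_def sum_distrib_right fps_sum_nth mult.assoc)
qed

theorem theorem4p1:
  fixes p :: nat
    and C :: "nat \<Rightarrow> ('d::{finite,linorder} \<Rightarrow> nat) \<Rightarrow> real"
    and a :: "'d \<Rightarrow> nat \<Rightarrow> complex"
  assumes "CARD('d) \<ge> 2" and "p \<ge> 1"
    and "char_eq_on_sequence p C a"
  shows "\<forall>r. pde_solution p C (V a r)"
proof
  fix r
  have "V a r = fps_action a 1 r" by (rule ext) (simp add: fps_action_def)
  then have "C_times p (V a r)" by (simp add: C_times_fps_action)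
  moreover have "pde_operator p C (V a r) x = 0" for x
    by (simp add: pde_operator_V char_series_eq_0[OF assms(3)] fps_action_def)
  ultimately show "pde_solution p C (V a r)" by (simp add: pde_solution_def)
qed

end
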